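(* Let $A \in M_n(\mathbb{C})$ with $\mathrm{rank}(A)=r>0$ be written in a Hartwig-Spindelböck decomposition $$A = U \begin{pmatrix} \Sigma Q & \Sigma P \\ 0 & 0\end{pmatrix} U^{*},$$ let $\tilde{Q} = Q(\Sigma Q)^{\mathrm{cep}}$ and $\tilde{\Delta} = \tilde{Q}\tilde{Q}^{\dagger}$. Then the CCE-inverse $A^{C,\mathrm{cep}}$ of $A$ is an EP matrix if and only if both of the following hold: (i) $Q^{*}\tilde{\Delta}Q = \tilde{Q}^{\dagger}\tilde{Q}$; (ii) $\tilde{\Delta}P = 0$. Moreover, if $A^{C,\mathrm{cep}}$ is an EP matrix, then (1) $[PP^{*},\tilde{\Delta}]=0$; (2) $[QQ^{*},\tilde{\Delta}]=0$; (3) $\tilde{\Delta} = Q\tilde{Q}^{\dagger}\tilde{Q}Q^{*}$, where $[X,Y]=XY-YX$.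
   Context: $M^{\dagger}$ is the Moore-Penrose inverse of $M$. A square matrix $M$ is EP if $MM^{\dagger}=M^{\dagger}M$. For a square matrix $M$ with index $k=\mathrm{Ind}(M)$ (the smallest non-negative integer with $\mathrm{rank}(M^{k})=\mathrm{rank}(M^{k+1})$), $M^{\mathrm{cep}}$ denotes the core-EP inverse of $M$: the unique $X$ with $XMX=X$ and $\mathcal{R}(X)=\mathcal{R}(X^{*})=\mathcal{R}(M^{k})$, where $\mathcal{R}$ is the column space. The CCE-inverse of $A$ is $A^{C,\mathrm{cep}} = A^{\dagger}A\,A^{\mathrm{cep}}\,AA^{\dagger}$. In a Hartwig-Spindelböck decomposition of a matrix $A\in M_n(\mathbb{C})$ of rank $r>0$, $U\in M_n(\mathbb{C})$ is unitary, $\Sigma = \mathrm{diag}(\sigma_1 I_{k_1},\dots,\sigma_t I_{k_t})\in M_r(\mathbb{C})$ is diagonal with the nonzero singular values $\sigma_j>0$ of $A$ on the diagonal ($k_1+\dots+k_t=r$), and $Q\in M_r(\mathbb{C})$, $P\in M_{r,n-r}(\mathbb{C})$ satisfy $QQ^{*}+PP^{*}=I_r$. Every nonzero matrix has such a decomposition. *)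

theory Defs
  imports
    "Jordan_Normal_Form.Schur_Decomposition"
    "Jordan_Normal_Form.DL_Rank"
    "Jordan_Normal_Form.Char_Poly"
begin

abbreviation mat_rank :: "complex mat \<Rightarrow> nat" where
  "mat_rank M \<equiv> vec_space.rank (dim_row M) M"

abbreviation mat_range :: "complex mat \<Rightarrow> complex vec set" where
  "mat_range M \<equiv> vec_space.col_space (dim_row M) M"

definition unitary_mat :: "complex mat \<Rightarrow> bool" where
  "unitary_mat U \<longleftrightarrow> square_mat U \<and>
     mat_adjoint U * U = 1\<^sub>m (dim_row U) \<and> U * mat_adjoint U = 1\<^sub>m (dim_row U)"

definition is_mp_inverse :: "complex mat \<Rightarrow> complex mat \<Rightarrow> bool" where
  "is_mp_inverse M X \<longleftrightarrow>
     X \<in> carrier_mat (dim_col M) (dim_row M) \<and>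
     M * X * M = M \<and> X * M * X = X \<and>
     mat_adjoint (M * X) = M * X \<and> mat_adjoint (X * M) = X * M"

definition mp_inverse :: "complex mat \<Rightarrow> complex mat" where
  "mp_inverse M = (THE X. is_mp_inverse M X)"

definition EP_mat :: "complex mat \<Rightarrow> bool" where
  "EP_mat M \<longleftrightarrow> square_mat M \<and> M * mp_inverse M = mp_inverse M * M"

definition mat_ind :: "complex mat \<Rightarrow> nat" where
  "mat_ind M = (LEAST k. mat_rank (M ^\<^sub>m k) = mat_rank (M ^\<^sub>m (k + 1)))"

definition is_core_EP_inverse :: "complex mat \<Rightarrow> complex mat \<Rightarrow> bool" where
  "is_core_EP_inverse M X \<longleftrightarrow>
     X \<in> carrier_mat (dim_row M) (dim_row M) \<and>
     X * M * X = X \<and>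
     mat_range X = mat_range (M ^\<^sub>m mat_ind M) \<and>
     mat_range (mat_adjoint X) = mat_range (M ^\<^sub>m mat_ind M)"

definition core_EP_inverse :: "complex mat \<Rightarrow> complex mat" where
  "core_EP_inverse M = (THE X. is_core_EP_inverse M X)"

definition CCE_inverse :: "complex mat \<Rightarrow> complex mat" where
  "CCE_inverse A = mp_inverse A * A * core_EP_inverse A * A * mp_inverse A"

definition singular_value :: "complex mat \<Rightarrow> real \<Rightarrow> bool" where
  "singular_value A s \<longleftrightarrow> 0 \<le> s \<and> eigenvalue (mat_adjoint A * A) (complex_of_real (s\<^sup>2))"

definition scalar_blocks :: "nat \<Rightarrow> (nat \<Rightarrow> real) \<Rightarrow> (nat \<Rightarrow> nat) \<Rightarrow> complex mat" where
  "scalar_blocks t \<sigma> k =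
     diag_block_mat (map (\<lambda>j. complex_of_real (\<sigma> j) \<cdot>\<^sub>m 1\<^sub>m (k j)) [0..<t])"

text \<open>
  The diagonal values are indexed from 0 and need be neither distinct nor ordered.
  The clause on singular values is a consequence of the others: these give
  A A* = U diag(S S, 0) U*.
\<close>

definition hartwig_spindelboeck ::
  "nat \<Rightarrow> nat \<Rightarrow> complex mat \<Rightarrow> complex mat \<Rightarrow> complex mat \<Rightarrow> complex mat \<Rightarrow> complex mat \<Rightarrow> bool" where
  "hartwig_spindelboeck n r A U S Q P \<longleftrightarrow>
     U \<in> carrier_mat n n \<and> unitary_mat U \<and>
     (\<exists>t \<sigma> k. S = scalar_blocks t \<sigma> k \<and> (\<Sum>j<t. k j) = r \<and>
        (\<forall>j<t. 0 < \<sigma> j \<and> 0 < k j) \<and>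
        \<sigma> ` {..<t} = {s. singular_value A s \<and> s \<noteq> 0}) \<and>
     Q \<in> carrier_mat r r \<and> P \<in> carrier_mat r (n - r) \<and>
     Q * mat_adjoint Q + P * mat_adjoint P = 1\<^sub>m r \<and>
     A = U * four_block_mat (S * Q) (S * P) (0\<^sub>m (n - r) r) (0\<^sub>m (n - r) (n - r)) * mat_adjoint U"

definition mat_commutator :: "complex mat \<Rightarrow> complex mat \<Rightarrow> complex mat" where
  "mat_commutator X Y = X * Y - Y * X"

end

theory Submission
  imports Defs
begin

text \<open>
  Split the unitary \<open>U\<close> into its first \<open>r\<close> columns \<open>L\<close> and the remaining ones \<open>K\<close>, and put
  \<open>W = L Q\<^sup>* + K P\<^sup>*\<close>. Then \<open>L\<close> and \<open>W\<close> are isometries with \<open>A = L \<Sigma> W\<^sup>*\<close>, \<open>W\<^sup>* L = Q\<close> and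
  \<open>W\<^sup>* K = P\<close>. Since \<open>A\<^bsup>j+1\<^esup> = L (\<Sigma>Q)\<^sup>j \<Sigma> W\<^sup>*\<close>, the core-EP inverse of \<open>A\<close> is that of \<open>\<Sigma>Q\<close>
  conjugated by \<open>L\<close>, so the CCE-inverse is \<open>X = W Qt L\<^sup>*\<close>, with Moore-Penrose inverse
  \<open>L Qt\<^sup>\<dagger> W\<^sup>*\<close>. Hence \<open>X\<close> is EP iff \<open>W \<Delta> W\<^sup>* = L Qt\<^sup>\<dagger> Qt L\<^sup>*\<close>; compressing this by \<open>L\<close> gives (i), and
  multiplying it by \<open>K\<close> gives (ii); conversely (ii) reduces \<open>W \<Delta>\<close> to \<open>L Q\<^sup>* \<Delta>\<close>.
\<close>

section \<open>Adjoints and left cancellation\<close>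

text \<open>The side conditions are dimension equations, not carrier memberships, so that the
  simplifier can settle them by dimension rules. As a rewrite rule it nests products to the right;
  flipped, it exposes an inner product that a known equation contracts.\<close>

lemma mult_assoc_dim:
  fixes A B C :: "'a::semiring_0 mat"
  assumes "dim_col A = dim_row B" "dim_col B = dim_row C"
  shows "A * B * C = A * (B * C)"
  using assms by (intro assoc_mult_mat[of A "dim_row A" "dim_row B" B "dim_row C" C "dim_col C"]) auto

lemma dim_mat_adjoint [simp]:
  "dim_row (mat_adjoint A) = dim_col A" "dim_col (mat_adjoint A) = dim_row A"
  by (simp_all add: mat_adjoint_def)

lemma index_mat_adjoint [simp]:
  assumes "i < dim_col A" "j < dim_row A"
  shows "mat_adjoint A $$ (i, j) = conjugate (A $$ (j, i))"
  using assms by (simp add: mat_adjoint_def mat_of_rows_def)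

lemma mat_adjoint_carrier [simp, intro]:
  "A \<in> carrier_mat m n \<Longrightarrow> mat_adjoint A \<in> carrier_mat n m"
  by (auto intro!: carrier_matI)

lemma mat_adjoint_adjoint [simp]: "mat_adjoint (mat_adjoint A) = A"
  by (intro eq_matI) auto

lemma mat_adjoint_one [simp]: "mat_adjoint (1\<^sub>m n) = (1\<^sub>m n :: complex mat)"
  by (intro eq_matI) auto

lemma mat_adjoint_zero [simp]: "mat_adjoint (0\<^sub>m m n) = (0\<^sub>m n m :: complex mat)"
  by (intro eq_matI) auto

lemma mat_adjoint_mult:
  fixes A B :: "complex mat"
  assumes "dim_col A = dim_row B"
  shows "mat_adjoint (A * B) = mat_adjoint B * mat_adjoint A"
  using assms
  by (intro eq_matI)
    (auto simp: scalar_prod_def mult.commute intro!: sum.cong)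

text \<open>The \<open>j\<close>-th diagonal entry of \<open>mat_adjoint A * A\<close> is the sum of
  the squared moduli in column \<open>j\<close>, so each of them vanishes.\<close>

lemma mat_adjoint_mult_self_eq_0:
  fixes A :: "complex mat"
  assumes "mat_adjoint A * A = 0\<^sub>m (dim_col A) (dim_col A)"
  shows "A = 0\<^sub>m (dim_row A) (dim_col A)"
proof (intro eq_matI)
  fix i j
  assume "i < dim_row (0\<^sub>m (dim_row A) (dim_col A) :: complex mat)"
    "j < dim_col (0\<^sub>m (dim_row A) (dim_col A) :: complex mat)"
  then have ij: "i < dim_row A" "j < dim_col A"
    by auto
  have "(mat_adjoint A * A) $$ (j, j) = (\<Sum>k<dim_row A. A $$ (k, j) * cnj (A $$ (k, j)))"
    using ij by (auto simp: scalar_prod_def atLeast0LessThan mult.commute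
        intro!: sum.cong)
  moreover have "(mat_adjoint A * A) $$ (j, j) = 0"
    using assms ij by simp
  ultimately have "complex_of_real (\<Sum>k<dim_row A. (cmod (A $$ (k, j)))\<^sup>2) = 0"
    by (simp only: of_real_sum complex_norm_square)
  then have "(\<Sum>k<dim_row A. (cmod (A $$ (k, j)))\<^sup>2) = 0"
    unfolding of_real_eq_0_iff .
  then show "A $$ (i, j) = 0\<^sub>m (dim_row A) (dim_col A) $$ (i, j)"
    using ij by (simp add: sum_nonneg_eq_0_iff)
qed auto

text \<open>For \<open>D = A * (X - Y)\<close> the hypothesis says that
  \<open>mat_adjoint A * D\<close> vanishes; hence so does \<open>mat_adjoint D * D\<close>, and
  therefore \<open>D\<close>.\<close>

lemma adjoint_mult_left_cancel:
  fixes A X Y :: "complex mat"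
  assumes A: "A \<in> carrier_mat m n" and X: "X \<in> carrier_mat n p" and Y: "Y \<in> carrier_mat n p"
    and eq: "mat_adjoint A * (A * X) = mat_adjoint A * (A * Y)"
  shows "A * X = A * Y"
proof -
  define D where "D = A * X - A * Y"
  have D: "D \<in> carrier_mat m p"
    using A X Y by (auto simp: D_def)
  have DA: "D = A * (X - Y)"
    using A X Y by (simp add: D_def mult_minus_distrib_mat)
  have "mat_adjoint A * D = 0\<^sub>m n p"
    using A X Y eq unfolding D_def
    by (subst mult_minus_distrib_mat[of _ n m _ p]) (auto simp del: assoc_mult_mat)
  moreover have "mat_adjoint D * D = mat_adjoint (X - Y) * (mat_adjoint A * D)"
  proof -
    have "mat_adjoint D = mat_adjoint (X - Y) * mat_adjoint A"
      using A X Y DA by (simp add: mat_adjoint_mult)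
    then show ?thesis
      using A X Y D by (simp add: mult_assoc_dim)
  qed
  ultimately have "mat_adjoint D * D = 0\<^sub>m (dim_col D) (dim_col D)"
    using X Y D by (simp add: right_mult_zero_mat[of _ p n])
  then have "D = 0\<^sub>m (dim_row D) (dim_col D)"
    by (rule mat_adjoint_mult_self_eq_0)
  then have D0: "D = 0\<^sub>m m p"
    using D by simp
  show ?thesis
  proof (intro eq_matI)
    fix i j assume ij: "i < dim_row (A * Y)" "j < dim_col (A * Y)"
    then have "D $$ (i, j) = 0"
      using A Y D0 by simp
    with ij A X Y show "(A * X) $$ (i, j) = (A * Y) $$ (i, j)"
      by (simp add: D_def del: index_mult_mat(1))
  qed (use A X Y in auto)
qed

section \<open>Powers, column spaces and their stabilisation\<close>

lemma pow_mat_add: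
  assumes "A \<in> carrier_mat n n"
  shows "A ^\<^sub>m (i + j) = A ^\<^sub>m i * A ^\<^sub>m j"
  using assms by (induction j) (auto simp: mult_assoc_dim)

lemma mat_adjoint_pow:
  fixes A :: "complex mat"
  assumes "A \<in> carrier_mat n n"
  shows "mat_adjoint (A ^\<^sub>m k) = mat_adjoint A ^\<^sub>m k"
proof (induction k)
  case (Suc k)
  \<comment> \<open>The power recursion adds its factor on the right, but the adjoint moves it to
    the left; writing it as a first power lets \<open>pow_mat_add\<close> absorb it there.\<close>
  have "mat_adjoint (A ^\<^sub>m Suc k) = mat_adjoint A ^\<^sub>m 1 * mat_adjoint A ^\<^sub>m k"
    using assms Suc by (simp add: mat_adjoint_mult)
  also have "\<dots> = mat_adjoint A ^\<^sub>m (1 + k)"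
    using assms by (intro pow_mat_add[symmetric]) auto
  finally show ?case
    by simp
qed (use assms in auto)

lemma mat_range_iff:
  "y \<in> mat_range A \<longleftrightarrow> (\<exists>x\<in>carrier_vec (dim_col A). y = A *\<^sub>v x)"
  by (subst vec_space.col_space_eq[of A "dim_row A" "dim_col A"])
    (auto intro!: mult_mat_vec_carrier[of _ _ "dim_col A"])

text \<open>The columns of \<open>Z\<close> are preimages under \<open>B\<close> of the columns of
  \<open>A\<close>. Range conditions thus become factorisations, which fit the algebraic arguments
  about generalised inverses.\<close>

lemma mat_range_subset_iff:
  assumes "dim_row A = dim_row B"
  shows "mat_range A \<subseteq> mat_range B \<longleftrightarrow> (\<exists>Z\<in>carrier_mat (dim_col B) (dim_col A). A = B * Z)"
proof
  assume sub: "mat_range A \<subseteq> mat_range B"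
  have "\<exists>z\<in>carrier_vec (dim_col B). col A j = B *\<^sub>v z" if "j < dim_col A" for j
  proof -
    have "col A j = A *\<^sub>v unit_vec (dim_col A) j"
      using that by (intro eq_vecI) auto
    then have "col A j \<in> mat_range A"
      by (auto simp: mat_range_iff)
    with sub have "col A j \<in> mat_range B" ..
    then show ?thesis
      by (auto simp: mat_range_iff)
  qed
  then obtain z where z: "\<And>j. j < dim_col A \<Longrightarrow> z j \<in> carrier_vec (dim_col B)"
    "\<And>j. j < dim_col A \<Longrightarrow> col A j = B *\<^sub>v z j"
    by metis
  define Z where "Z = mat_of_cols (dim_col B) (map z [0..<dim_col A])"
  have "A = B * Z"
  proof (intro mat_col_eqI)
    fix j assume "j < dim_col (B * Z)"
    then have "j < dim_col A"
      by (simp add: Z_def)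
    then show "col A j = col (B * Z) j"
      using z by (subst col_mult2[of _ "dim_row B" "dim_col B" _ "dim_col A"])
        (auto simp: Z_def intro!: carrier_matI)
  qed (auto simp: Z_def assms)
  then show "\<exists>Z\<in>carrier_mat (dim_col B) (dim_col A). A = B * Z"
    by (intro bexI[of _ Z]) (auto simp: Z_def intro!: carrier_matI)
next
  assume "\<exists>Z\<in>carrier_mat (dim_col B) (dim_col A). A = B * Z"
  then obtain Z where Z: "Z \<in> carrier_mat (dim_col B) (dim_col A)" "A = B * Z"
    by blast
  show "mat_range A \<subseteq> mat_range B"
  proof
    fix y assume "y \<in> mat_range A"
    then obtain x where x: "x \<in> carrier_vec (dim_col A)" "y = A *\<^sub>v x"
      by (auto simp: mat_range_iff)
    have "y = B *\<^sub>v (Z *\<^sub>v x)"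
      using assoc_mult_mat_vec[OF carrier_mat_triv Z(1) x(1)] unfolding x(2) Z(2)[symmetric] .
    then show "y \<in> mat_range B"
      unfolding mat_range_iff by (rule bexI[OF _ mult_mat_vec_carrier[OF Z(1) x(1)]])
  qed
qed

lemma mat_range_subsetE:
  assumes "mat_range A \<subseteq> mat_range B" "A \<in> carrier_mat m p" "B \<in> carrier_mat m q"
  obtains Z where "Z \<in> carrier_mat q p" "A = B * Z"
  using assms mat_range_subset_iff[of A B] by auto

lemma mat_range_subsetI:
  assumes "A = B * Z" "B \<in> carrier_mat m q" "Z \<in> carrier_mat q p"
  shows "mat_range A \<subseteq> mat_range B"
  using assms mat_range_subset_iff[of A B] by auto

text \<open>A maximal independent set \<open>U\<close> of columns of \<open>A\<close> has
  \<open>rank A\<close> elements and stays independent in the span of the columns of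
  \<open>B\<close>, whose dimension is \<open>rank B\<close>. If the ranks agree, \<open>U\<close>
  is a basis of that span.\<close>

lemma (in vec_space) rank_mono_col_space:
  assumes A: "A \<in> carrier_mat n p" and B: "B \<in> carrier_mat n q"
    and sub: "col_space A \<subseteq> col_space B"
  shows "rank A \<le> rank B" "rank A = rank B \<Longrightarrow> col_space A = col_space B"
proof -
  have cA: "set (cols A) \<subseteq> carrier_vec n" and cB: "set (cols B) \<subseteq> carrier_vec n"
    using A B cols_dim by blast+
  obtain U where U: "finite U" "maximal U (\<lambda>T. T \<subseteq> set (cols A) \<and> lin_indpt T)"
    using maximal_exists_superset[of "set (cols A)" "\<lambda>T. T \<subseteq> set (cols A) \<and> lin_indpt T" "{}"]
    by (auto simp: lin_dep_def)
  have rA: "rank A = card U"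
    by (rule rank_card_indpt[OF A U(2)])
  have Usub: "U \<subseteq> set (cols A)" and Uli: "lin_indpt U"
    using U(2) by (auto simp: maximal_def)
  let ?W = "span_vs (set (cols B))"
  have spsub: "submodule class_ring (span (set (cols B))) V"
    using cB by (intro span_is_submodule) auto
  \<comment> \<open>The span is made a vector space in its own right, since the dimension bounds are
    relative to it; \<open>span_li_not_depend\<close> transfers independence and spans between it
    and the ambient space.\<close>
  interpret W: vectorspace class_ring ?W
    using cB by (intro subspace_is_vs span_is_subspace) auto
  have UW: "U \<subseteq> span (set (cols B))"
    using Usub sub in_own_span[of "set (cols A)"] cA unfolding col_space_def by auto
  have liW: "W.lin_indpt U"
    using span_li_not_depend(2)[OF UW spsub] Uli by simp
  have fdW: "W.fin_dim"
    unfolding W.fin_dim_def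
    using span_li_not_depend(1)[OF _ spsub, of "set (cols B)"] in_own_span[of "set (cols B)"] cB
    by (intro exI[of _ "set (cols B)"]) auto
  show "rank A \<le> rank B"
    unfolding rA rank_def[of B] using fdW UW liW by (intro W.li_le_dim(2)) auto
  assume eq: "rank A = rank B"
  have "W.basis U"
    using fdW U(1) UW liW eq unfolding rA rank_def[of B] by (intro W.dim_li_is_basis) auto
  then have "W.span U = span (set (cols B))"
    by (auto simp: W.basis_def)
  then have "span U = col_space B"
    using span_li_not_depend(1)[OF UW spsub] unfolding col_space_def by simp
  moreover have "span U \<subseteq> col_space A"
    using Usub unfolding col_space_def by (intro span_is_monotone)
  ultimately show "col_space A = col_space B"
    using sub by auto
qed

text \<open>Ranges of powers decrease, and equal ranks at the index force equal ranges, that is,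
  \<open>M ^\<^sub>m k = M ^\<^sub>m Suc k * Z\<close>. This factorisation survives multiplication
  by further powers on the left, so the ranges never shrink again.\<close>

lemma mat_range_pow_mat_ind:
  assumes M: "M \<in> carrier_mat n n" and j: "mat_ind M \<le> j"
  shows "mat_range (M ^\<^sub>m j) = mat_range (M ^\<^sub>m mat_ind M)"
proof -
  have dims: "dim_row (M ^\<^sub>m i) = n" "dim_col (M ^\<^sub>m i) = n" for i
    using M by auto
  have decr: "mat_range (M ^\<^sub>m Suc i) \<subseteq> mat_range (M ^\<^sub>m i)" for i
    using pow_carrier_mat[OF M] M by (intro mat_range_subsetI[of _ _ M n n n]) auto
  have rank_step: "mat_rank (M ^\<^sub>m Suc i) \<le> mat_rank (M ^\<^sub>m i)"
    and rank_eq: "mat_rank (M ^\<^sub>m Suc i) = mat_rank (M ^\<^sub>m i) \<Longrightarrow>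
      mat_range (M ^\<^sub>m Suc i) = mat_range (M ^\<^sub>m i)" for i
    using vec_space.rank_mono_col_space[of "M ^\<^sub>m Suc i" n n "M ^\<^sub>m i" n] decr[of i] M
    by (auto simp: dims)
  \<comment> \<open>\<open>LEAST\<close> is meaningful only if some exponent qualifies. Otherwise
    the rank would drop at every step, which is impossible for more steps than the initial
    rank.\<close>
  have "\<exists>k. mat_rank (M ^\<^sub>m k) = mat_rank (M ^\<^sub>m (k + 1))"
  proof (rule ccontr)
    assume "\<not> ?thesis"
    then have lt: "mat_rank (M ^\<^sub>m Suc k) < mat_rank (M ^\<^sub>m k)" for k
      using rank_step[of k] by (metis Suc_eq_plus1 le_neq_implies_less)
    have "mat_rank (M ^\<^sub>m k) + k \<le> mat_rank (M ^\<^sub>m 0)" for k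
    proof (induction k)
      case (Suc k)
      then show ?case
        using lt[of k] by linarith
    qed simp
    from this[of "Suc (mat_rank (M ^\<^sub>m 0))"] show False
      by linarith
  qed
  then have "mat_rank (M ^\<^sub>m mat_ind M) = mat_rank (M ^\<^sub>m (mat_ind M + 1))"
    unfolding mat_ind_def by (rule LeastI_ex)
  then have "mat_range (M ^\<^sub>m Suc (mat_ind M)) = mat_range (M ^\<^sub>m mat_ind M)"
    by (intro rank_eq) simp
  then obtain Z where Z: "Z \<in> carrier_mat n n" "M ^\<^sub>m mat_ind M = M ^\<^sub>m Suc (mat_ind M) * Z"
    by (rule mat_range_subsetE[OF equalityD2 pow_carrier_mat[OF M] pow_carrier_mat[OF M]])
  have stable: "mat_range (M ^\<^sub>m i) \<subseteq> mat_range (M ^\<^sub>m Suc i)" if le: "mat_ind M \<le> i" for i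
  proof -
    obtain d where d: "i = d + mat_ind M"
      using le_Suc_ex[OF le] by (auto simp: add.commute)
    have "M ^\<^sub>m i = M ^\<^sub>m d * (M ^\<^sub>m Suc (mat_ind M) * Z)"
      by (simp only: d pow_mat_add[OF M] Z(2)[symmetric])
    also have "\<dots> = M ^\<^sub>m (d + Suc (mat_ind M)) * Z"
      unfolding pow_mat_add[OF M, of d "Suc (mat_ind M)"]
      using M Z(1) by (intro mult_assoc_dim[symmetric]) auto
    finally have "M ^\<^sub>m i = M ^\<^sub>m Suc i * Z"
      unfolding d add_Suc_right .
    then show ?thesis
      using pow_carrier_mat[OF M] Z(1) by (rule mat_range_subsetI)
  qed
  show ?thesis
    using j
  proof (induction rule: dec_induct)
    case (step i)
    have "mat_range (M ^\<^sub>m Suc i) = mat_range (M ^\<^sub>m i)"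
      using decr stable[OF step.hyps(1)] by (rule equalityI)
    then show ?case
      using step.IH
      by (rule trans)
  qed (rule refl)
qed

lemma pow_mat_eq_pow_Suc_mult:
  assumes M: "M \<in> carrier_mat n n" and j: "mat_ind M \<le> j"
  obtains Z where "Z \<in> carrier_mat n n" "M ^\<^sub>m j = M ^\<^sub>m Suc j * Z"
proof -
  have "mat_range (M ^\<^sub>m j) \<subseteq> mat_range (M ^\<^sub>m Suc j)"
    using mat_range_pow_mat_ind[OF M j] mat_range_pow_mat_ind[OF M, of "Suc j"] j by simp
  then show ?thesis
    using that by (rule mat_range_subsetE[OF _ pow_carrier_mat[OF M] pow_carrier_mat[OF M]])
qed

section \<open>The Moore-Penrose inverse\<close>

text \<open>Since the products are Hermitian, taking adjoints of \<open>M * Y * M * X\<close> yields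
  \<open>M * X = M * Y\<close>, and similarly \<open>X * M = Y * M\<close>. Then
  \<open>X = X * M * X = X * M * Y = Y * M * Y = Y\<close>.\<close>

lemma mp_inverse_unique:
  assumes X: "is_mp_inverse M X" and Y: "is_mp_inverse M Y"
  shows "X = Y"
proof -
  let ?H = mat_adjoint
  have dims [simp]: "dim_row X = dim_col M" "dim_col X = dim_row M"
    "dim_row Y = dim_col M" "dim_col Y = dim_row M"
    using X Y by (auto simp: is_mp_inverse_def)
  note [simp] = mult_assoc_dim mat_adjoint_mult
  from X have X1: "M * (X * M) = M" and X2: "X * (M * X) = X"
    and X3: "?H (M * X) = M * X" and X4: "?H (X * M) = X * M"
    by (auto simp: is_mp_inverse_def)
  from Y have Y1: "M * (Y * M) = M" and Y2: "Y * (M * Y) = Y"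
    and Y3: "?H (M * Y) = M * Y" and Y4: "?H (Y * M) = Y * M"
    by (auto simp: is_mp_inverse_def)
  have "M * X = ?H (M * (Y * M) * X)"
    unfolding Y1 X3 ..
  also have "\<dots> = ?H (M * X) * ?H (M * Y)"
    by simp
  also have "\<dots> = M * (X * M) * Y"
    unfolding X3 Y3 by simp
  finally have MX: "M * X = M * Y"
    unfolding X1 .
  have "X * M = ?H (X * (M * (Y * M)))"
    unfolding Y1 X4 ..
  also have "\<dots> = ?H (Y * M) * ?H (X * M)"
    by simp
  also have "\<dots> = Y * (M * (X * M))"
    unfolding X4 Y4 by simp
  finally have XM: "X * M = Y * M"
    unfolding X1 .
  have "X = X * M * Y"
    using X2 MX by simp
  then show ?thesis
    unfolding XM using Y2 by simp
qed

lemma mp_inverse_eqI: "is_mp_inverse M X \<Longrightarrow> mp_inverse M = X"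
  unfolding mp_inverse_def by (blast intro: the_equality mp_inverse_unique)

text \<open>At the index \<open>k\<close>, the factorisation
  \<open>H ^\<^sub>m k = H ^\<^sub>m Suc k * Z\<close> implies
  \<open>H ^\<^sub>m Suc k = H ^\<^sub>m Suc k * (H * Z)\<close>. As \<open>H\<close> is its own
  adjoint, the excess factors cancel from the left one at a time, leaving
  \<open>H = H * (H * Z)\<close>.\<close>

lemma hermitian_eq_square_mult:
  fixes H :: "complex mat"
  assumes H: "H \<in> carrier_mat n n" and herm: "mat_adjoint H = H"
  obtains K where "K \<in> carrier_mat n n" "H = H * (H * K)"
proof -
  obtain Z where Z: "Z \<in> carrier_mat n n" "H ^\<^sub>m mat_ind H = H ^\<^sub>m Suc (mat_ind H) * Z"
    using pow_mat_eq_pow_Suc_mult[OF H order_refl] .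
  have pow_Suc: "H ^\<^sub>m Suc k * X = H * (H ^\<^sub>m k * X)" if "X \<in> carrier_mat n n" for X k
    using pow_mat_add[OF H, of 1 k] H that by (simp add: mult_assoc_dim)
  \<comment> \<open>The cancellation stops at one remaining factor \<open>H\<close>, which may be
    singular.\<close>
  have "H * X = H * Y" if "X \<in> carrier_mat n n" "Y \<in> carrier_mat n n"
    "H ^\<^sub>m Suc k * X = H ^\<^sub>m Suc k * Y" for X Y k
    using that(3)
  proof (induction k)
    case (Suc k)
    have "mat_adjoint H * (H * (H ^\<^sub>m k * X)) = mat_adjoint H * (H * (H ^\<^sub>m k * Y))"
      using Suc.prems unfolding herm pow_Suc[OF that(1)] pow_Suc[OF that(2)] .
    then have "H * (H ^\<^sub>m k * X) = H * (H ^\<^sub>m k * Y)"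
      using H that by (elim adjoint_mult_left_cancel[rotated 3]) auto
    then show ?case
      by (intro Suc.IH) (simp only: pow_Suc that)
  qed (use H in auto)
  moreover have "H ^\<^sub>m Suc (mat_ind H) * 1\<^sub>m n = H ^\<^sub>m Suc (mat_ind H) * (H * Z)"
  proof -
    have "H ^\<^sub>m Suc (mat_ind H) * 1\<^sub>m n = H * (H ^\<^sub>m mat_ind H * 1\<^sub>m n)"
      by (rule pow_Suc) simp
    also have "\<dots> = H * (H ^\<^sub>m Suc (mat_ind H) * Z)"
      using H by (simp only: Z(2)[symmetric] right_mult_one_mat[OF pow_carrier_mat])
    also have "\<dots> = H * (H ^\<^sub>m mat_ind H * (H * Z))"
      using H Z(1) by (simp add: mult_assoc_dim)
    also have "\<dots> = H ^\<^sub>m Suc (mat_ind H) * (H * Z)"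
      using H Z(1) by (intro pow_Suc[symmetric]) auto
    finally show ?thesis .
  qed
  ultimately have "H * 1\<^sub>m n = H * (H * Z)"
    using H Z(1) by (metis mult_carrier_mat one_carrier_mat)
  then show ?thesis
    using that[OF Z(1)] H by simp
qed

text \<open>With \<open>H = M\<^sup>* M = H\<^sup>2 K\<close>, the matrix \<open>G = K\<^sup>* H K\<close> is the Moore-Penrose inverse of \<open>H\<close>
  and \<open>G M\<^sup>*\<close> that of \<open>M\<close>.\<close>

lemma mp_inverse_exists: "\<exists>X. is_mp_inverse M X"
proof -
  define m n where "m = dim_row M" and "n = dim_col M"
  have M [simp]: "dim_row M = m" "dim_col M = n"
    by (simp_all add: m_def n_def)
  let ?A = mat_adjoint
  define H where "H = ?A M * M"
  have H [simp]: "dim_row H = n" "dim_col H = n" and herm: "?A H = H"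
    by (simp_all add: H_def mat_adjoint_mult)
  then obtain K where "K \<in> carrier_mat n n" and HK: "H * (H * K) = H"
    using hermitian_eq_square_mult[of H n] by (metis carrier_matI)
  then have K [simp]: "dim_row K = n" "dim_col K = n"
    by auto
  note [simp] = mult_assoc_dim mat_adjoint_mult herm
  have KH: "?A K * (H * H) = H"
    using arg_cong[OF HK, of ?A] by simp
  \<comment> \<open>Both sides equal \<open>mat_adjoint K * (H * (H * K))\<close>. So
    \<open>H * K\<close> is Hermitian, which is what later makes \<open>G * H\<close> and
    \<open>H * G\<close> the same matrix.\<close>
  have KH_eq: "?A K * H = H * K"
  proof -
    have "?A K * H = ?A K * (H * (H * K))"
      unfolding HK ..
    also have "\<dots> = ?A K * (H * H) * K"
      by simp
    finally show ?thesis
      unfolding KH .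
  qed
  have HKH: "H * (K * H) = H"
  proof -
    have "H * (K * H) = ?A K * H * H"
      unfolding KH_eq by simp
    then show ?thesis
      using KH by simp
  qed
  define G where "G = ?A K * (H * K)"
  have G [simp]: "dim_row G = n" "dim_col G = n" "?A G = G"
    by (simp_all add: G_def)
  have G_eq: "G = H * (K * K)"
    using arg_cong[OF KH_eq, of "\<lambda>X. X * K"] by (simp add: G_def)
  have HG: "H * G = H * K"
  proof -
    have "H * G = H * (?A K * H) * K"
      by (simp add: G_def)
    also have "\<dots> = H * (H * K) * K"
      unfolding KH_eq ..
    finally show ?thesis
      unfolding HK .
  qed
  have GH: "G * H = H * K"
  proof -
    have "?A (H * G) = ?A (H * K)"
      unfolding HG ..
    then show ?thesis
      by (simp add: KH_eq)
  qed
  have GHG: "G * (H * G) = G"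
  proof -
    have "G * (H * G) = (G * H) * G"
      by simp
    also have "\<dots> = H * K * G"
      unfolding GH ..
    also have "\<dots> = H * (K * H) * (K * K)"
      unfolding G_eq by simp
    finally show ?thesis
      unfolding HKH G_eq .
  qed
  have MGH: "M * (G * H) = M"
  proof -
    \<comment> \<open>After multiplication by \<open>mat_adjoint M\<close> the claim reads
      \<open>H * (G * H) = H\<close>; the explicit identity matrix gives both sides the shape
      required by \<open>adjoint_mult_left_cancel\<close>.\<close>
    have "?A M * (M * (G * H)) = ?A M * (M * 1\<^sub>m n)"
    proof -
      have "?A M * (M * (G * H)) = H * (G * H)"
        by (simp add: H_def)
      also have "\<dots> = H"
        unfolding GH by (rule HK)
      finally show ?thesis
        by (simp add: H_def right_mult_one_mat')
    qed
    then have "M * (G * H) = M * 1\<^sub>m n"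
      by (intro adjoint_mult_left_cancel[of M m n _ n]) (auto intro!: carrier_matI)
    then show ?thesis
      by (simp add: right_mult_one_mat')
  qed
  have "is_mp_inverse M (G * ?A M)"
    unfolding is_mp_inverse_def
  proof (intro conjI)
    show "G * ?A M \<in> carrier_mat (dim_col M) (dim_row M)"
      by (intro carrier_matI) auto
    show "M * (G * ?A M) * M = M"
      using MGH by (simp add: H_def)
    have "G * ?A M * M * (G * ?A M) = G * (H * G) * ?A M"
      by (simp add: H_def)
    then show "G * ?A M * M * (G * ?A M) = G * ?A M"
      unfolding GHG .
    show "?A (M * (G * ?A M)) = M * (G * ?A M)"
      by simp
    have eq: "G * ?A M * M = G * H"
      by (simp add: H_def)
    show "?A (G * ?A M * M) = G * ?A M * M"
      unfolding eq by (simp add: HG GH KH_eq)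
  qed
  then show ?thesis ..
qed

lemma is_mp_inverse_mp_inverse: "is_mp_inverse M (mp_inverse M)"
  using mp_inverse_exists[of M] mp_inverse_eqI by auto

section \<open>The core-EP inverse\<close>

text \<open>\<open>N\<close> is a power of \<open>M\<close> whose exponent reaches the indices of
  both \<open>M\<close> and \<open>mat_adjoint M\<close>. The first index yields the right factor
  \<open>Z\<close>, the second, after taking adjoints, the left factor \<open>Z'\<close>.\<close>

lemma stable_power:
  assumes M: "M \<in> carrier_mat n n"
  obtains N Z Z' where "N \<in> carrier_mat n n" "Z \<in> carrier_mat n n" "Z' \<in> carrier_mat n n"
    "M * N = N * M" "N = M * (N * Z)" "N = Z' * (M * N)"
    "mat_range N = mat_range (M ^\<^sub>m mat_ind M)"
proof -
  let ?A = mat_adjoint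
  have AM: "?A M \<in> carrier_mat n n"
    using M by simp
  define j where "j = max (mat_ind M) (mat_ind (?A M))"
  define N where "N = M ^\<^sub>m j"
  have N: "N \<in> carrier_mat n n"
    using M by (simp add: N_def)
  have comm: "M * N = N * M"
    using pow_mat_add[OF M, of 1 j] M by (simp add: N_def)
  obtain Z where Z: "Z \<in> carrier_mat n n" "M ^\<^sub>m j = M ^\<^sub>m Suc j * Z"
    using pow_mat_eq_pow_Suc_mult[OF M, of j] by (auto simp: j_def)
  obtain Y where Y: "Y \<in> carrier_mat n n" "?A M ^\<^sub>m j = ?A M ^\<^sub>m Suc j * Y"
    using pow_mat_eq_pow_Suc_mult[OF AM, of j] by (auto simp: j_def)
  show thesis
  proof (rule that[of N Z "?A Y"])
    have "N = N * M * Z"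
      using Z(2) by (simp add: N_def)
    then show "N = M * (N * Z)"
      unfolding comm[symmetric] using M N Z(1) by (simp add: mult_assoc_dim)
    have "?A (?A N) = ?A (?A (N * M) * Y)"
      using Y(2) mat_adjoint_pow[OF M, of j] mat_adjoint_pow[OF M, of "Suc j"] by (simp add: N_def)
    then show "N = ?A Y * (M * N)"
      unfolding comm using M N Y(1) by (simp add: mat_adjoint_mult)
    show "mat_range N = mat_range (M ^\<^sub>m mat_ind M)"
      unfolding N_def by (rule mat_range_pow_mat_ind[OF M]) (simp add: j_def)
  qed (use N Z Y comm in auto)
qed

text \<open>\<open>E = N * mp_inverse N\<close> is the orthogonal projection onto the range of
  \<open>N\<close>. The range of \<open>mat_adjoint X\<close> lies there, so
  \<open>X * E = X\<close>. Since \<open>N\<close> also factors through \<open>X\<close> and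
  \<open>X * M * X = X\<close>, the product \<open>M * X\<close> fixes \<open>E\<close>; hence
  \<open>M * X = M * X * E = E\<close>.\<close>

lemma mult_core_EP_inverse:
  assumes M: "M \<in> carrier_mat n n" and X: "is_core_EP_inverse M X"
    and N: "N \<in> carrier_mat n n" and Z: "Z \<in> carrier_mat n n"
    and comm: "M * N = N * M" and NZ: "N = M * (N * Z)"
    and range: "mat_range N = mat_range (M ^\<^sub>m mat_ind M)"
  shows "M * X = N * mp_inverse N" "X * (N * mp_inverse N) = X" "X * (M * N) = N"
proof -
  let ?A = mat_adjoint
  define P where "P = mp_inverse N"
  define E where "E = N * P"
  have [simp]: "dim_row M = n" "dim_col M = n" "dim_row N = n" "dim_col N = n"
    "dim_row Z = n" "dim_col Z = n"
    using M N Z by auto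
  have X': "X \<in> carrier_mat n n"
    using X M by (simp add: is_core_EP_inverse_def)
  then have [simp]: "dim_row X = n" "dim_col X = n"
    by auto
  have XMX: "X * (M * X) = X"
    using X by (simp add: is_core_EP_inverse_def mult_assoc_dim)
  have rX: "mat_range X = mat_range N" "mat_range (?A X) = mat_range N"
    using X unfolding is_core_EP_inverse_def range by blast+
  have P: "dim_row P = n" "dim_col P = n" "E * N = N" "?A E = E"
    using is_mp_inverse_mp_inverse[of N] by (auto simp: is_mp_inverse_def P_def E_def)
  note [simp] = P(1,2) mult_assoc_dim mat_adjoint_mult
  have [simp]: "dim_row E = n" "dim_col E = n"
    by (simp_all add: E_def)
  obtain T where T: "T \<in> carrier_mat n n" "X = N * T"
    by (rule mat_range_subsetE[OF equalityD1[OF rX(1)] X' N])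
  obtain T' where T': "T' \<in> carrier_mat n n" "N = X * T'"
    by (rule mat_range_subsetE[OF equalityD2[OF rX(1)] N X'])
  obtain R where R: "R \<in> carrier_mat n n" "?A X = N * R"
    by (rule mat_range_subsetE[OF equalityD1[OF rX(2)] mat_adjoint_carrier[OF X'] N])
  have [simp]: "dim_row T = n" "dim_col T = n" "dim_row T' = n" "dim_col T' = n"
    "dim_row R = n" "dim_col R = n"
    using T(1) T'(1) R(1) by auto
  have "E * ?A X = ?A X"
    unfolding R(2) using P(3) by (simp flip: mult_assoc_dim)
  then have "?A (E * ?A X) = X"
    by simp
  then have XE: "X * E = X"
    by (simp add: P(4))
  have "M * X * E = E"
  proof -
    \<comment> \<open>In this form \<open>E\<close> starts with \<open>M * X\<close>, so a further
      \<open>M * X\<close> in front of it is absorbed by \<open>X * (M * X) = X\<close>.\<close>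
    have "E = M * (X * T' * Z) * P"
      unfolding E_def T'(2)[symmetric] NZ[symmetric] ..
    then have "M * X * E = M * X * (M * (X * T' * Z) * P)"
      by (rule arg_cong)
    also have "\<dots> = M * (X * (M * X)) * (T' * Z * P)"
      by simp
    also have "\<dots> = M * (X * T' * Z) * P"
      unfolding XMX by simp
    also have "\<dots> = E"
      unfolding E_def T'(2)[symmetric] NZ[symmetric] ..
    finally show ?thesis .
  qed
  then show "M * X = N * mp_inverse N"
    using XE by (simp add: E_def P_def)
  show "X * (N * mp_inverse N) = X"
    using XE by (simp add: E_def P_def)
  have "X * (M * (X * T')) = X * (M * X) * T'"
    by simp
  then show "X * (M * N) = N"
    unfolding XMX T'(2)[symmetric] .
qed

text \<open>\<open>M * X\<close> and \<open>M * Y\<close> are the same projection, so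
  \<open>X = X * (M * Y)\<close>; with \<open>Y = N * T\<close> and \<open>X * (M * N) = N\<close>
  this equals \<open>Y\<close>.\<close>

lemma core_EP_inverse_unique:
  assumes M: "M \<in> carrier_mat n n" and X: "is_core_EP_inverse M X" and Y: "is_core_EP_inverse M Y"
  shows "X = Y"
proof -
  obtain N Z where N: "N \<in> carrier_mat n n" "Z \<in> carrier_mat n n"
    "M * N = N * M" "N = M * (N * Z)" "mat_range N = mat_range (M ^\<^sub>m mat_ind M)"
    using stable_power[OF M] by metis
  have X': "X \<in> carrier_mat n n" and Y': "Y \<in> carrier_mat n n"
    using X Y M by (simp_all add: is_core_EP_inverse_def)
  have rY: "mat_range Y = mat_range N"
    using Y unfolding is_core_EP_inverse_def N(5) by blast
  obtain T where T: "T \<in> carrier_mat n n" "Y = N * T"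
    by (rule mat_range_subsetE[OF equalityD1[OF rY] Y' N(1)])
  note mX = mult_core_EP_inverse[OF M X N] and mY = mult_core_EP_inverse[OF M Y N]
  have "X = X * (M * Y)"
    unfolding mY(1) mX(2) ..
  also have "\<dots> = X * (M * N) * T"
    unfolding T(2) using M X' N(1) T(1) by (simp add: mult_assoc_dim)
  finally show ?thesis
    unfolding mX(3) T(2) .
qed

lemma core_EP_inverse_eqI:
  assumes "M \<in> carrier_mat n n" "is_core_EP_inverse M X"
  shows "core_EP_inverse M = X"
  unfolding core_EP_inverse_def
  using assms by (blast intro: the_equality core_EP_inverse_unique)

text \<open>If \<open>N\<close> is a high power of \<open>M\<close> and \<open>N = M N Z\<close>, then \<open>X = N Z N\<^sup>\<dagger>\<close> is the core-EP inverse,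
  because \<open>M X = N N\<^sup>\<dagger>\<close> is the orthogonal projection onto the range of \<open>N\<close>.\<close>

lemma core_EP_inverse_exists:
  assumes M: "M \<in> carrier_mat n n"
  shows "\<exists>X. is_core_EP_inverse M X"
proof -
  let ?A = mat_adjoint
  obtain N Z Z' where N: "N \<in> carrier_mat n n" and Z: "Z \<in> carrier_mat n n" "Z' \<in> carrier_mat n n"
    and comm: "M * N = N * M" and NZ: "M * (N * Z) = N" and ZN: "Z' * (M * N) = N"
    and range: "mat_range N = mat_range (M ^\<^sub>m mat_ind M)"
    using stable_power[OF M] by metis
  define P where "P = mp_inverse N"
  have P: "P \<in> carrier_mat n n" "N * (P * N) = N" "P * (N * P) = P" "?A (N * P) = N * P"
    using is_mp_inverse_mp_inverse[of N] N by (auto simp: is_mp_inverse_def P_def mult_assoc_dim)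
  have [simp]: "dim_row M = n" "dim_col M = n" "dim_row N = n" "dim_col N = n"
    "dim_row Z = n" "dim_col Z = n" "dim_row Z' = n" "dim_col Z' = n" "dim_row P = n" "dim_col P = n"
    using M N Z P by auto
  note [simp] = mult_assoc_dim
  define X where "X = N * (Z * P)"
  have [simp]: "dim_row X = n" "dim_col X = n"
    by (simp_all add: X_def)
  have X: "X \<in> carrier_mat n n"
    by (rule carrier_matI) simp_all
  have MX: "M * X = N * P"
  proof -
    have "M * X = M * (N * Z) * P"
      by (simp add: X_def)
    then show ?thesis
      unfolding NZ .
  qed
  have XE: "X * (N * P) = X"
  proof -
    have "X * (N * P) = N * (Z * (P * (N * P)))"
      by (simp add: X_def)
    then show ?thesis
      unfolding P(3) by (simp add: X_def)
  qed
  have MXMN: "M * (X * (M * N)) = M * N"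
  proof -
    have "M * (X * (M * N)) = M * X * (N * M)"
      unfolding comm by simp
    also have "\<dots> = N * (P * N) * M"
      unfolding MX by simp
    finally show ?thesis
      unfolding P(2) comm .
  qed
  \<comment> \<open>The leading \<open>N\<close> of \<open>X\<close> is replaced by
    \<open>Z' * (M * N)\<close>, which produces \<open>M * (X * (M * N))\<close>; then
    \<open>Z'\<close> strips the \<open>M\<close> again.\<close>
  have XMN: "X * (M * N) = N"
  proof -
    have "X * (M * N) = N * (Z * (P * (M * N)))"
      by (simp add: X_def)
    also have "\<dots> = Z' * (M * N) * (Z * (P * (M * N)))"
      unfolding ZN ..
    also have "\<dots> = Z' * (M * (X * (M * N)))"
      by (simp add: X_def)
    finally show ?thesis
      unfolding MXMN ZN .
  qed
  have "is_core_EP_inverse M X"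
    unfolding is_core_EP_inverse_def range[symmetric]
  proof (intro conjI equalityI)
    show "X \<in> carrier_mat (dim_row M) (dim_row M)"
      using X by simp
    show "X * M * X = X"
      by (simp add: MX XE)
    show "mat_range X \<subseteq> mat_range N"
      by (rule mat_range_subsetI[OF X_def N mult_carrier_mat[OF Z(1) P(1)]])
    show "mat_range N \<subseteq> mat_range X"
      by (rule mat_range_subsetI[OF XMN[symmetric] X mult_carrier_mat[OF M N]])
    have "?A X = ?A (X * (N * P))"
      unfolding XE ..
    also have "\<dots> = N * P * ?A X"
      by (simp add: mat_adjoint_mult P(4)[unfolded mat_adjoint_mult])
    also have "\<dots> = N * (P * ?A X)"
      by simp
    finally show "mat_range (?A X) \<subseteq> mat_range N"
      by (rule mat_range_subsetI[OF _ N mult_carrier_mat[OF P(1) mat_adjoint_carrier[OF X]]])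
    \<comment> \<open>\<open>M * X\<close> is Hermitian and fixes \<open>N\<close>, so its adjoint
      does too, and that adjoint begins with \<open>mat_adjoint X\<close>.\<close>
    have "N = ?A (M * X) * N"
      unfolding MX P(4) using P(2) by simp
    then have "N = ?A X * (?A M * N)"
      by (simp add: mat_adjoint_mult)
    then show "mat_range N \<subseteq> mat_range (?A X)"
      by (rule mat_range_subsetI[OF _ mat_adjoint_carrier[OF X]
            mult_carrier_mat[OF mat_adjoint_carrier[OF M] N]])
  qed
  then show ?thesis ..
qed

lemma is_core_EP_inverse_core_EP_inverse:
  "M \<in> carrier_mat n n \<Longrightarrow> is_core_EP_inverse M (core_EP_inverse M)"
  using core_EP_inverse_exists core_EP_inverse_eqI by metis

section \<open>Transport along the isometries \<open>L\<close> and \<open>W\<close>\<close>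

text \<open>In a power of \<open>A\<close> each inner \<open>mat_adjoint W * L\<close> joins an
  \<open>S\<close> to form \<open>M\<close>, hence the shift of the exponent by one. As
  \<open>S * mat_adjoint W\<close> and \<open>mat_adjoint L\<close> have right inverses
  \<open>W * Si\<close> and \<open>L\<close>, both ranges are the image under \<open>L\<close> of
  the range of \<open>M ^\<^sub>m i\<close>.\<close>

lemma mat_range_isometry_mult:
  fixes L W S Si C :: "complex mat"
  assumes L: "L \<in> carrier_mat n r" and W: "W \<in> carrier_mat n r"
    and S: "S \<in> carrier_mat r r" and Si: "Si \<in> carrier_mat r r"
    and LL: "mat_adjoint L * L = 1\<^sub>m r" and WW: "mat_adjoint W * W = 1\<^sub>m r" and SSi: "S * Si = 1\<^sub>m r"
    and A: "A = L * (S * mat_adjoint W)" and M: "M = S * (mat_adjoint W * L)"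
    and C: "C \<in> carrier_mat r r" "mat_range C = mat_range (M ^\<^sub>m i)"
  shows "mat_range (L * (C * mat_adjoint L)) = mat_range (A ^\<^sub>m Suc i)"
proof -
  have [simp]: "dim_row L = n" "dim_col L = r" "dim_row W = n" "dim_col W = r"
    "dim_row S = r" "dim_col S = r" "dim_row Si = r" "dim_col Si = r" "dim_row C = r" "dim_col C = r"
    "dim_row M = r" "dim_col M = r" "dim_row A = n" "dim_col A = n"
    using assms by auto
  note [simp] = mult_assoc_dim
  have M': "M \<in> carrier_mat r r" and A': "A \<in> carrier_mat n n"
    by (rule carrier_matI; simp)+
  have [simp]: "dim_row (M ^\<^sub>m k) = r" "dim_col (M ^\<^sub>m k) = r" for k
    using pow_carrier_mat[OF M'] by auto
  have pow: "A ^\<^sub>m Suc k = L * (M ^\<^sub>m k * (S * mat_adjoint W))" for k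
  proof (induction k)
    case (Suc k)
    have "A ^\<^sub>m Suc (Suc k) = L * (M ^\<^sub>m k * (S * mat_adjoint W)) * A"
      unfolding Suc.IH[symmetric] by simp
    then show ?case
      by (simp add: A M)
  qed (simp add: A)
  have right_inv: "S * (mat_adjoint W * (W * (Si * X))) = X" if "X \<in> carrier_mat r p" for X p
  proof -
    have "S * (mat_adjoint W * (W * (Si * X))) = S * (mat_adjoint W * W) * (Si * X)"
      using that by simp
    also have "\<dots> = S * Si * X"
      unfolding WW using that S Si by simp
    finally show ?thesis
      unfolding SSi using that by simp
  qed
  have left_inv: "mat_adjoint L * (L * X) = X" if "X \<in> carrier_mat r p" for X p
    using LL that by (simp flip: mult_assoc_dim)
  obtain T where T: "T \<in> carrier_mat r r" "C = M ^\<^sub>m i * T"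
    by (rule mat_range_subsetE[OF equalityD1[OF C(2)] C(1) pow_carrier_mat[OF M']])
  obtain T' where T': "T' \<in> carrier_mat r r" "M ^\<^sub>m i = C * T'"
    by (rule mat_range_subsetE[OF equalityD2[OF C(2)] pow_carrier_mat[OF M'] C(1)])
  have [simp]: "dim_row T = r" "dim_col T = r" "dim_row T' = r" "dim_col T' = r"
    using T(1) T'(1) by auto
  show ?thesis
  proof (rule equalityI)
    have "L * (C * mat_adjoint L) =
        L * (M ^\<^sub>m i * (S * (mat_adjoint W * (W * (Si * (T * mat_adjoint L))))))"
      unfolding T(2) by (subst right_inv[of _ n]) (auto intro!: carrier_matI)
    also have "\<dots> = A ^\<^sub>m Suc i * (W * (Si * (T * mat_adjoint L)))"
      unfolding pow by simp
    finally show "mat_range (L * (C * mat_adjoint L)) \<subseteq> mat_range (A ^\<^sub>m Suc i)"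
      by (rule mat_range_subsetI[OF _ pow_carrier_mat[OF A']]) (rule carrier_matI; simp)
    have "A ^\<^sub>m Suc i = L * (C * (mat_adjoint L * (L * (T' * (S * mat_adjoint W)))))"
      unfolding pow T'(2) by (subst left_inv[of _ n]) (auto intro!: carrier_matI)
    also have "\<dots> = L * (C * mat_adjoint L) * (L * (T' * (S * mat_adjoint W)))"
      by simp
    finally show "mat_range (A ^\<^sub>m Suc i) \<subseteq> mat_range (L * (C * mat_adjoint L))"
      by (rule mat_range_subsetI[of _ _ _ n n n]) (rule carrier_matI; simp)+
  qed
qed

text \<open>For \<open>L * (C * mat_adjoint L)\<close> the equation \<open>X * A * X = X\<close>
  reduces to \<open>C * (M * C) = C\<close>. Both range conditions are instances of
  \<open>mat_range_isometry_mult\<close>, for \<open>C\<close> and for its adjoint.\<close>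

lemma core_EP_inverse_isometry:
  fixes L W S Si :: "complex mat"
  assumes L: "L \<in> carrier_mat n r" and W: "W \<in> carrier_mat n r"
    and S: "S \<in> carrier_mat r r" and Si: "Si \<in> carrier_mat r r"
    and LL: "mat_adjoint L * L = 1\<^sub>m r" and WW: "mat_adjoint W * W = 1\<^sub>m r" and SSi: "S * Si = 1\<^sub>m r"
    and A: "A = L * (S * mat_adjoint W)" and M: "M = S * (mat_adjoint W * L)"
  shows "core_EP_inverse A = L * (core_EP_inverse M * mat_adjoint L)"
proof -
  define C where "C = core_EP_inverse M"
  have [simp]: "dim_row L = n" "dim_col L = r" "dim_row W = n" "dim_col W = r"
    "dim_row S = r" "dim_col S = r" "dim_row M = r" "dim_col M = r" "dim_row A = n" "dim_col A = n"
    using assms by auto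
  have M': "M \<in> carrier_mat r r" and A': "A \<in> carrier_mat n n"
    by (rule carrier_matI; simp)+
  have cep: "is_core_EP_inverse M C"
    unfolding C_def by (rule is_core_EP_inverse_core_EP_inverse[OF M'])
  have C: "C \<in> carrier_mat r r"
    using cep by (simp add: is_core_EP_inverse_def)
  then have [simp]: "dim_row C = r" "dim_col C = r"
    by auto
  note [simp] = mult_assoc_dim
  have CMC: "C * (M * C) = C"
    using cep by (simp add: is_core_EP_inverse_def)
  \<comment> \<open>With this common exponent, the ranges of \<open>M ^\<^sub>m i\<close> and
    \<open>A ^\<^sub>m Suc i\<close> have both stabilised.\<close>
  define i where "i = max (mat_ind M) (mat_ind A)"
  have range_M: "mat_range (M ^\<^sub>m i) = mat_range (M ^\<^sub>m mat_ind M)"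
    by (rule mat_range_pow_mat_ind[OF M']) (simp add: i_def)
  have range_A: "mat_range (A ^\<^sub>m Suc i) = mat_range (A ^\<^sub>m mat_ind A)"
    by (rule mat_range_pow_mat_ind[OF A']) (simp add: i_def)
  have range_C: "mat_range C = mat_range (M ^\<^sub>m i)" "mat_range (mat_adjoint C) = mat_range (M ^\<^sub>m i)"
    using cep unfolding is_core_EP_inverse_def range_M by blast+
  note range = mat_range_isometry_mult[OF L W S Si LL WW SSi A M]
  have adj: "mat_adjoint (L * (C * mat_adjoint L)) = L * (mat_adjoint C * mat_adjoint L)"
    by (simp add: mat_adjoint_mult)
  have "is_core_EP_inverse A (L * (C * mat_adjoint L))"
    unfolding is_core_EP_inverse_def
  proof (intro conjI)
    show "L * (C * mat_adjoint L) \<in> carrier_mat (dim_row A) (dim_row A)"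
      by (rule carrier_matI) simp_all
    have "L * (C * mat_adjoint L) * A * (L * (C * mat_adjoint L))
        = L * (C * (mat_adjoint L * L * (M * (C * mat_adjoint L))))"
      by (simp add: A M)
    also have "\<dots> = L * (C * (M * C) * mat_adjoint L)"
      unfolding LL by simp
    finally show "L * (C * mat_adjoint L) * A * (L * (C * mat_adjoint L)) = L * (C * mat_adjoint L)"
      unfolding CMC .
    show "mat_range (L * (C * mat_adjoint L)) = mat_range (A ^\<^sub>m mat_ind A)"
      unfolding range_A[symmetric] by (rule range[OF C range_C(1)])
    show "mat_range (mat_adjoint (L * (C * mat_adjoint L))) = mat_range (A ^\<^sub>m mat_ind A)"
      unfolding range_A[symmetric] adj by (rule range[OF mat_adjoint_carrier[OF C] range_C(2)])
  qed
  then show ?thesis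
    unfolding C_def by (rule core_EP_inverse_eqI[OF A'])
qed

text \<open>In each Penrose equation the inner products \<open>mat_adjoint L * L\<close> and
  \<open>mat_adjoint W * W\<close> cancel, leaving the equation for \<open>B\<close> and
  \<open>Y\<close>.\<close>

lemma mp_inverse_isometry:
  fixes L W B Y :: "complex mat"
  assumes L: "L \<in> carrier_mat n r" and W: "W \<in> carrier_mat n r" and B: "B \<in> carrier_mat r r"
    and LL: "mat_adjoint L * L = 1\<^sub>m r" and WW: "mat_adjoint W * W = 1\<^sub>m r"
    and Y: "is_mp_inverse B Y"
  shows "mp_inverse (L * (B * mat_adjoint W)) = W * (Y * mat_adjoint L)"
proof (rule mp_inverse_eqI)
  have [simp]: "dim_row L = n" "dim_col L = r" "dim_row W = n" "dim_col W = r"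
    "dim_row B = r" "dim_col B = r" "dim_row Y = r" "dim_col Y = r"
    using assms by (auto simp: is_mp_inverse_def)
  note [simp] = mult_assoc_dim mat_adjoint_mult
  have cancel: "mat_adjoint L * (L * X) = X" "mat_adjoint W * (W * X) = X"
    if "dim_row X = r" for X
    using LL WW that by (simp_all flip: mult_assoc_dim)
  have Y': "B * (Y * B) = B" "Y * (B * Y) = Y"
    "mat_adjoint (B * Y) = B * Y" "mat_adjoint (Y * B) = Y * B"
    using Y by (auto simp: is_mp_inverse_def simp del: mat_adjoint_mult)
  \<comment> \<open>The Penrose equations are restated with a trailing factor \<open>Z\<close> so
    that they apply inside right-nested products.\<close>
  have "B * (Y * (B * Z)) = B * Z" "Y * (B * (Y * Z)) = Y * Z" if "dim_row Z = r" for Z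
    using Y'(1,2) that by (simp_all flip: mult_assoc_dim)
  moreover have "mat_adjoint Y * (mat_adjoint B * Z) = B * (Y * Z)"
    "mat_adjoint B * (mat_adjoint Y * Z) = Y * (B * Z)" if "dim_row Z = r" for Z
    using Y'(3,4) that by (simp_all flip: mult_assoc_dim)
  ultimately show "is_mp_inverse (L * (B * mat_adjoint W)) (W * (Y * mat_adjoint L))"
    unfolding is_mp_inverse_def by (auto simp: cancel intro!: carrier_matI)
qed

text \<open>As \<open>mp_inverse A = W * (Si * mat_adjoint L)\<close>, the outer projections are
  \<open>mp_inverse A * A = W * mat_adjoint W\<close> and
  \<open>A * mp_inverse A = L * mat_adjoint L\<close>; around \<open>L * (C * mat_adjoint L)\<close>
  they leave \<open>Q = mat_adjoint W * L\<close> next to \<open>C\<close>.\<close>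

lemma CCE_inverse_isometry:
  fixes L W S Si :: "complex mat"
  assumes L: "L \<in> carrier_mat n r" and W: "W \<in> carrier_mat n r"
    and S: "S \<in> carrier_mat r r" and Si: "Si \<in> carrier_mat r r"
    and LL: "mat_adjoint L * L = 1\<^sub>m r" and WW: "mat_adjoint W * W = 1\<^sub>m r"
    and SSi: "S * Si = 1\<^sub>m r" and SiS: "Si * S = 1\<^sub>m r"
    and A: "A = L * (S * mat_adjoint W)" and Q: "Q = mat_adjoint W * L"
  shows "CCE_inverse A = W * (Q * core_EP_inverse (S * Q) * mat_adjoint L)"
proof -
  define C where "C = core_EP_inverse (S * Q)"
  have "S * Q \<in> carrier_mat r r"
    using S W L Q by auto
  from is_core_EP_inverse_core_EP_inverse[OF this]
  have "dim_row C = r" "dim_col C = r"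
    using S by (auto simp: C_def is_core_EP_inverse_def)
  then have [simp]: "dim_row L = n" "dim_col L = r" "dim_row W = n" "dim_col W = r"
    "dim_row S = r" "dim_col S = r" "dim_row Si = r" "dim_col Si = r"
    "dim_row C = r" "dim_col C = r"
    using assms by auto
  have "is_mp_inverse S Si"
    using S Si SSi SiS by (simp add: is_mp_inverse_def)
  then have mp: "mp_inverse A = W * (Si * mat_adjoint L)"
    unfolding A by (rule mp_inverse_isometry[OF L W S LL WW])
  have cep: "core_EP_inverse A = L * (C * mat_adjoint L)"
    unfolding C_def Q by (rule core_EP_inverse_isometry[OF L W S Si LL WW SSi A refl])
  note [simp] = mult_assoc_dim
  have cancel: "mat_adjoint L * (L * X) = X" "mat_adjoint W * (W * X) = X"
    "S * (Si * X) = X" "Si * (S * X) = X" if "dim_row X = r" for X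
    using LL WW SSi SiS that by (simp_all flip: mult_assoc_dim)
  show ?thesis
    unfolding CCE_inverse_def mp cep C_def[symmetric] unfolding A Q
    by (simp add: cancel)
qed

lemma EP_CCE_inverse_isometry:
  fixes L K S Si Q P A W Qt :: "complex mat"
  assumes L: "L \<in> carrier_mat n r" and K: "K \<in> carrier_mat n m"
    and S: "S \<in> carrier_mat r r" and Si: "Si \<in> carrier_mat r r"
    and Q: "Q \<in> carrier_mat r r" and P: "P \<in> carrier_mat r m"
    and LL: "mat_adjoint L * L = 1\<^sub>m r" and KK: "mat_adjoint K * K = 1\<^sub>m m"
    and LK: "mat_adjoint L * K = 0\<^sub>m r m"
    and SSi: "S * Si = 1\<^sub>m r" and SiS: "Si * S = 1\<^sub>m r"
    and QP: "Q * mat_adjoint Q + P * mat_adjoint P = 1\<^sub>m r"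
    and W: "W = L * mat_adjoint Q + K * mat_adjoint P"
    and A: "A = L * (S * mat_adjoint W)"
    and Qt: "Qt = Q * core_EP_inverse (S * Q)"
    and D: "D = Qt * mp_inverse Qt"
  shows "EP_mat (CCE_inverse A) \<longleftrightarrow>
    mat_adjoint Q * D * Q = mp_inverse Qt * Qt \<and> D * P = 0\<^sub>m r m"
proof -
  let ?A = mat_adjoint
  have W': "W \<in> carrier_mat n r"
    using L K Q P W by auto
  have "is_core_EP_inverse (S * Q) (core_EP_inverse (S * Q))"
    using S Q by (intro is_core_EP_inverse_core_EP_inverse[of _ r]) auto
  then have Qt': "Qt \<in> carrier_mat r r"
    using S Q by (auto simp: Qt is_core_EP_inverse_def)
  define Y where "Y = mp_inverse Qt"
  have Y: "is_mp_inverse Qt Y"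
    unfolding Y_def by (rule is_mp_inverse_mp_inverse)
  then have [simp]: "dim_row Y = r" "dim_col Y = r"
    using Qt' by (auto simp: is_mp_inverse_def)
  have [simp]: "dim_row L = n" "dim_col L = r" "dim_row W = n" "dim_col W = r"
    "dim_row K = n" "dim_col K = m" "dim_row Q = r" "dim_col Q = r" "dim_row P = r" "dim_col P = m"
    "dim_row Qt = r" "dim_col Qt = r" "dim_row D = r" "dim_col D = r"
    using L K Q P W' Qt' by (auto simp: D Y_def[symmetric])
  note [simp] = mult_assoc_dim
  have herm: "?A D = D"
    using Y by (simp add: is_mp_inverse_def D Y_def)
  have LW: "?A L * W = ?A Q"
  proof -
    have "?A L * W = ?A L * (L * ?A Q) + ?A L * (K * ?A P)"
      unfolding W using L K Q P by (intro mult_add_distrib_mat[of _ r n _ r]) auto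
    also have "\<dots> = (?A L * L) * ?A Q + (?A L * K) * ?A P"
      by simp
    finally show ?thesis
      unfolding LL LK using Q P by simp
  qed
  have KL: "?A K * L = 0\<^sub>m m r"
    using arg_cong[OF LK, of ?A] by (simp add: mat_adjoint_mult)
  have KW: "?A K * W = ?A P"
  proof -
    have "?A K * W = ?A K * (L * ?A Q) + ?A K * (K * ?A P)"
      unfolding W using L K Q P by (intro mult_add_distrib_mat[of _ m n _ r]) auto
    also have "\<dots> = (?A K * L) * ?A Q + (?A K * K) * ?A P"
      by simp
    finally show ?thesis
      unfolding KK KL using Q P by simp
  qed
  have WL: "?A W * L = Q" and WK: "?A W * K = P"
    using arg_cong[OF LW, of ?A] arg_cong[OF KW, of ?A] by (simp_all add: mat_adjoint_mult)
  \<comment> \<open>The normalisation \<open>QP\<close> enters here: it is what makes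
    \<open>W\<close> an isometry.\<close>
  have WW: "?A W * W = 1\<^sub>m r"
  proof -
    have "?A W * W = ?A W * (L * ?A Q) + ?A W * (K * ?A P)"
      by (subst (2) W) (use L K Q P W' in \<open>auto intro!: mult_add_distrib_mat[of _ r n _ r]\<close>)
    also have "\<dots> = (?A W * L) * ?A Q + (?A W * K) * ?A P"
      by simp
    finally show ?thesis
      unfolding WL WK QP .
  qed
  have CCE: "CCE_inverse A = W * (Qt * ?A L)"
    unfolding Qt using CCE_inverse_isometry[OF L W' S Si LL WW SSi SiS A WL[symmetric]] .
  have mp: "mp_inverse (CCE_inverse A) = L * (Y * ?A W)"
    unfolding CCE by (rule mp_inverse_isometry[OF W' L Qt' WW LL Y])
  have "CCE_inverse A * mp_inverse (CCE_inverse A) = W * (Qt * (?A L * L * (Y * ?A W)))"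
    unfolding mp unfolding CCE by simp
  then have left: "CCE_inverse A * mp_inverse (CCE_inverse A) = W * (D * ?A W)"
    unfolding LL by (simp add: D Y_def[symmetric])
  have "mp_inverse (CCE_inverse A) * CCE_inverse A = L * (Y * (?A W * W * (Qt * ?A L)))"
    unfolding mp unfolding CCE by simp
  then have right: "mp_inverse (CCE_inverse A) * CCE_inverse A = L * (Y * (Qt * ?A L))"
    unfolding WW by simp
  have EP: "EP_mat (CCE_inverse A) \<longleftrightarrow> W * (D * ?A W) = L * (Y * (Qt * ?A L))"
    unfolding EP_mat_def left right by (simp add: CCE)
  show ?thesis
    unfolding EP Y_def[symmetric]
  proof (intro iffI conjI; (elim conjE)?)
    assume eq: "W * (D * ?A W) = L * (Y * (Qt * ?A L))"
    have "?A Q * D * Q = ?A L * W * D * (?A W * L)"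
      unfolding LW WL ..
    also have "\<dots> = ?A L * (W * (D * ?A W)) * L"
      by simp
    also have "\<dots> = ?A L * L * (Y * (Qt * (?A L * L)))"
      unfolding eq by simp
    finally show "?A Q * D * Q = Y * Qt"
      unfolding LL by simp
    \<comment> \<open>Multiplying by \<open>mat_adjoint W\<close> on the left isolates
      \<open>D\<close>; multiplying by \<open>K\<close> on the right annihilates the other side,
      since \<open>mat_adjoint L * K\<close> vanishes.\<close>
    have "D * P = ?A W * W * (D * (?A W * K))"
      unfolding WW WK by simp
    also have "\<dots> = ?A W * (W * (D * ?A W)) * K"
      by simp
    also have "\<dots> = ?A W * (L * (Y * (Qt * (?A L * K))))"
      unfolding eq by simp
    also have "\<dots> = 0\<^sub>m r m"
      unfolding LK using L W' Qt' by (simp add: right_mult_zero_mat'[of _ r])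
    finally show "D * P = 0\<^sub>m r m" .
  next
    assume i: "?A Q * D * Q = Y * Qt" and ii: "D * P = 0\<^sub>m r m"
    \<comment> \<open>Because \<open>D\<close> is Hermitian, (ii) can be read from the left as well,
      which removes the \<open>K\<close> component of \<open>W * D\<close>.\<close>
    have PD: "?A P * D = 0\<^sub>m m r"
      using arg_cong[OF ii, of ?A] by (simp add: mat_adjoint_mult herm)
    have "W * D = L * (?A Q * D) + K * (?A P * D)"
    proof -
      have "W * D = (L * ?A Q) * D + (K * ?A P) * D"
        unfolding W by (intro add_mult_distrib_mat[of _ n r _ _ r]) (rule carrier_matI; simp)+
      then show ?thesis
        by simp
    qed
    then have WD: "W * D = L * (?A Q * D)"
      unfolding PD using right_add_zero_mat[of "L * (?A Q * D)" n r] by (simp add: carrier_matI)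
    have DW: "D * ?A W = D * (Q * ?A L)"
      using arg_cong[OF WD, of ?A] by (simp add: mat_adjoint_mult herm)
    have "W * (D * ?A W) = W * D * (Q * ?A L)"
      unfolding DW by simp
    also have "\<dots> = L * (?A Q * D * Q) * ?A L"
      unfolding WD by simp
    finally show "W * (D * ?A W) = L * (Y * (Qt * ?A L))"
      unfolding i by simp
  qed
qed

section \<open>From the Hartwig-Spindelboeck decomposition to isometries\<close>

text \<open>Induction splits off the last scalar block. A second application, to the reciprocals,
  yields the inverse on the other side.\<close>

lemma scalar_blocks_inverse:
  assumes "\<forall>j<t. \<sigma> j \<noteq> 0"
  shows "scalar_blocks t \<sigma> k * scalar_blocks t (\<lambda>j. inverse (\<sigma> j)) k = 1\<^sub>m (\<Sum>j<t. k j)"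
  using assms
proof (induction t)
  case (Suc t)
  define B where "B = (\<lambda>\<sigma>. scalar_blocks t \<sigma> k)"
  have B: "B \<sigma> \<in> carrier_mat (\<Sum>j<t. k j) (\<Sum>j<t. k j)" for \<sigma>
    by (rule carrier_matI)
      (simp_all add: B_def scalar_blocks_def dim_diag_block_mat o_def sum_list_distinct_conv_sum_set
        atLeast0LessThan)
  have last: "scalar_blocks (Suc t) \<sigma> k =
      four_block_mat (B \<sigma>) (0\<^sub>m (\<Sum>j<t. k j) (k t)) (0\<^sub>m (k t) (\<Sum>j<t. k j))
        (complex_of_real (\<sigma> t) \<cdot>\<^sub>m 1\<^sub>m (k t))" for \<sigma>
    using B[of \<sigma>] by (simp add: scalar_blocks_def diag_block_mat_last Let_def B_def[symmetric]
        del: diag_block_mat.simps) (simp add: B_def scalar_blocks_def)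
  have "complex_of_real (\<sigma> t) \<cdot>\<^sub>m 1\<^sub>m (k t) * (complex_of_real (inverse (\<sigma> t)) \<cdot>\<^sub>m 1\<^sub>m (k t)) = 1\<^sub>m (k t)"
    using Suc.prems by (intro eq_matI) auto
  moreover have "B \<sigma> * B (\<lambda>j. inverse (\<sigma> j)) = 1\<^sub>m (\<Sum>j<t. k j)"
    using Suc by (simp add: B_def)
  ultimately show ?case
    unfolding last
    by (subst mult_four_block_mat[OF B _ _ _ B])
      (use B in \<open>auto simp: left_mult_zero_mat[OF B] right_mult_zero_mat[OF B]\<close>)
qed (auto simp: scalar_blocks_def intro: eq_matI)

text \<open>\<open>E\<close> and \<open>F\<close> are the first \<open>r\<close> and the last
  \<open>m\<close> columns of the identity matrix. Their adjoints place \<open>X\<close> and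
  \<open>Y\<close> side by side, and the outer \<open>E\<close> appends the zero rows.\<close>

lemma four_block_mat_upper_eq:
  fixes X Y :: "complex mat"
  assumes X: "X \<in> carrier_mat r r" and Y: "Y \<in> carrier_mat r m"
  defines "E \<equiv> mat (r + m) r (\<lambda>(i, j). of_bool (i = j))"
    and "F \<equiv> mat (r + m) m (\<lambda>(i, j). of_bool (i = r + j))"
  shows "four_block_mat X Y (0\<^sub>m m r) (0\<^sub>m m m) = E * (X * mat_adjoint E + Y * mat_adjoint F)"
    and "mat_adjoint E * E = 1\<^sub>m r" "mat_adjoint F * F = 1\<^sub>m m" "mat_adjoint E * F = 0\<^sub>m r m"
proof -
  have "X * mat_adjoint E = mat r (r + m) (\<lambda>(i, j). if j < r then X $$ (i, j) else 0)"
    using X by (intro eq_matI) (auto simp: E_def scalar_prod_def sum.delta if_distrib of_bool_def cong: if_cong)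
  moreover have "Y * mat_adjoint F = mat r (r + m) (\<lambda>(i, j). if j < r then 0 else Y $$ (i, j - r))"
    (is "_ = ?R")
  proof (intro eq_matI)
    fix i j assume "i < dim_row ?R" "j < dim_col ?R"
    then have ij: "i < r" "j < r + m"
      by auto
    have "(Y * mat_adjoint F) $$ (i, j) = (\<Sum>k<m. Y $$ (i, k) * of_bool (j = r + k))"
      using Y ij by (auto simp: F_def scalar_prod_def atLeast0LessThan of_bool_def intro!: sum.cong)
    \<comment> \<open>For \<open>j < r\<close> the truncated difference \<open>j - r\<close> is 0,
      so the inner guard is what keeps the term \<open>k = 0\<close> from contributing.\<close>
    also have "\<dots> = (\<Sum>k<m. if k = j - r then (if j < r then 0 else Y $$ (i, k)) else 0)"
      using ij by (intro sum.cong) auto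
    finally show "(Y * mat_adjoint F) $$ (i, j) = ?R $$ (i, j)"
      using ij by (auto simp: sum.delta)
  qed (use Y in \<open>auto simp: F_def\<close>)
  ultimately have sum: "X * mat_adjoint E + Y * mat_adjoint F =
      mat r (r + m) (\<lambda>(i, j). if j < r then X $$ (i, j) else Y $$ (i, j - r))"
    by (intro eq_matI) auto
  show "four_block_mat X Y (0\<^sub>m m r) (0\<^sub>m m m) = E * (X * mat_adjoint E + Y * mat_adjoint F)"
    unfolding sum
  proof (intro eq_matI)
    let ?R = "mat r (r + m) (\<lambda>(i, j). if j < r then X $$ (i, j) else Y $$ (i, j - r))"
    fix i j assume "i < dim_row (E * ?R)" "j < dim_col (E * ?R)"
    then have ij: "i < r + m" "j < r + m"
      by (auto simp: E_def)
    have "(E * ?R) $$ (i, j) = (\<Sum>k<r. of_bool (i = k) * ?R $$ (k, j))"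
      using ij by (auto simp: E_def scalar_prod_def atLeast0LessThan intro!: sum.cong)
    also have "\<dots> = (\<Sum>k<r. if k = i then ?R $$ (k, j) else 0)"
      by (intro sum.cong) auto
    finally show "four_block_mat X Y (0\<^sub>m m r) (0\<^sub>m m m) $$ (i, j) = (E * ?R) $$ (i, j)"
      using X Y ij by (auto simp: sum.delta)
  qed (use X Y in \<open>auto simp: E_def\<close>)
  show "mat_adjoint E * E = 1\<^sub>m r"
  proof (intro eq_matI)
    fix i j assume "i < dim_row (1\<^sub>m r :: complex mat)" "j < dim_col (1\<^sub>m r :: complex mat)"
    then have ij: "i < r" "j < r"
      by auto
    have "(mat_adjoint E * E) $$ (i, j) = (\<Sum>k<r + m. of_bool (k = i) * of_bool (k = j))"
      using ij by (auto simp: E_def scalar_prod_def atLeast0LessThan intro!: sum.cong)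
    also have "\<dots> = (\<Sum>k<r + m. if k = i then of_bool (i = j) else 0)"
      by (intro sum.cong) auto
    finally show "(mat_adjoint E * E) $$ (i, j) = 1\<^sub>m r $$ (i, j)"
      using ij by (simp add: sum.delta)
  qed (auto simp: E_def)
  show "mat_adjoint F * F = 1\<^sub>m m"
  proof (intro eq_matI)
    fix i j assume "i < dim_row (1\<^sub>m m :: complex mat)" "j < dim_col (1\<^sub>m m :: complex mat)"
    then have ij: "i < m" "j < m"
      by auto
    have "(mat_adjoint F * F) $$ (i, j) = (\<Sum>k<r + m. of_bool (k = r + i) * of_bool (k = r + j))"
      using ij by (auto simp: F_def scalar_prod_def atLeast0LessThan intro!: sum.cong)
    also have "\<dots> = (\<Sum>k<r + m. if k = r + i then of_bool (i = j) else 0)"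
      by (intro sum.cong) auto
    finally show "(mat_adjoint F * F) $$ (i, j) = 1\<^sub>m m $$ (i, j)"
      using ij by (simp add: sum.delta)
  qed (auto simp: F_def)
  show "mat_adjoint E * F = 0\<^sub>m r m"
  proof (intro eq_matI)
    fix i j assume "i < dim_row (0\<^sub>m r m :: complex mat)" "j < dim_col (0\<^sub>m r m :: complex mat)"
    then have ij: "i < r" "j < m"
      by auto
    have "(mat_adjoint E * F) $$ (i, j) = (\<Sum>k<r + m. of_bool (k = i) * of_bool (k = r + j))"
      using ij by (auto simp: E_def F_def scalar_prod_def atLeast0LessThan intro!: sum.cong)
    also have "\<dots> = 0"
      using ij by (intro sum.neutral) auto
    finally show "(mat_adjoint E * F) $$ (i, j) = 0\<^sub>m r m $$ (i, j)"
      using ij by simp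
  qed (auto simp: E_def F_def)
qed

text \<open>\<open>L = U * E\<close> and \<open>K = U * F\<close> are the first \<open>r\<close> and
  the remaining columns of \<open>U\<close>; \<open>Si\<close> consists of the reciprocal scalar
  blocks.\<close>

lemma hartwig_spindelboeck_isometries:
  assumes hs: "hartwig_spindelboeck n r A U S Q P" and r: "r \<le> n"
  obtains L K Si where "L \<in> carrier_mat n r" "K \<in> carrier_mat n (n - r)"
    "S \<in> carrier_mat r r" "Si \<in> carrier_mat r r" "S * Si = 1\<^sub>m r" "Si * S = 1\<^sub>m r"
    "mat_adjoint L * L = 1\<^sub>m r" "mat_adjoint K * K = 1\<^sub>m (n - r)" "mat_adjoint L * K = 0\<^sub>m r (n - r)"
    "A = L * (S * mat_adjoint (L * mat_adjoint Q + K * mat_adjoint P))"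
proof -
  let ?A = mat_adjoint
  obtain t \<sigma> k where S: "S = scalar_blocks t \<sigma> k" and k: "(\<Sum>j<t. k j) = r"
    and pos: "\<forall>j<t. 0 < \<sigma> j"
    using hs by (auto simp: hartwig_spindelboeck_def)
  from hs have U: "U \<in> carrier_mat n n" "?A U * U = 1\<^sub>m n"
    and Q: "Q \<in> carrier_mat r r" and P: "P \<in> carrier_mat r (n - r)"
    and A: "A = U * four_block_mat (S * Q) (S * P) (0\<^sub>m (n - r) r) (0\<^sub>m (n - r) (n - r)) * ?A U"
    by (auto simp: hartwig_spindelboeck_def unitary_mat_def)
  define Si where "Si = scalar_blocks t (\<lambda>j. inverse (\<sigma> j)) k"
  have dims: "scalar_blocks t \<tau> k \<in> carrier_mat r r" for \<tau>
    by (rule carrier_matI)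
      (simp_all add: scalar_blocks_def dim_diag_block_mat o_def sum_list_distinct_conv_sum_set
        atLeast0LessThan k)
  have S': "S \<in> carrier_mat r r" and Si: "Si \<in> carrier_mat r r"
    by (simp_all add: S Si_def dims)
  have SSi: "S * Si = 1\<^sub>m r"
    unfolding S Si_def k[symmetric] using pos by (intro scalar_blocks_inverse) auto
  have SiS: "Si * S = 1\<^sub>m r"
    using scalar_blocks_inverse[of t "\<lambda>j. inverse (\<sigma> j)" k] pos unfolding S Si_def k by force
  define E where "E = (mat n r (\<lambda>(i, j). of_bool (i = j)) :: complex mat)"
  define F where "F = (mat n (n - r) (\<lambda>(i, j). of_bool (i = r + j)) :: complex mat)"
  have "S * Q \<in> carrier_mat r r" "S * P \<in> carrier_mat r (n - r)"
    using S' Q P by auto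
  note block = four_block_mat_upper_eq[OF this, unfolded le_add_diff_inverse[OF r], folded E_def F_def]
  have [simp]: "dim_row E = n" "dim_col E = r" "dim_row F = n" "dim_col F = n - r"
    "dim_row U = n" "dim_col U = n" "dim_row S = r" "dim_col S = r"
    "dim_row Q = r" "dim_col Q = r" "dim_row P = r" "dim_col P = n - r"
    using U S' Q P by (auto simp: E_def F_def)
  note [simp] = mult_assoc_dim mat_adjoint_mult
  have cancel: "?A U * (U * X) = X" if "dim_row X = n" for X
    using U that by (simp flip: mult_assoc_dim)
  have adj: "?A (X + Y) = ?A X + ?A Y" if "X \<in> carrier_mat n r" "Y \<in> carrier_mat n r"
    for X Y :: "complex mat"
    using that by (intro eq_matI) (auto simp: conjugate_dist_add)
  show thesis
  proof (rule that[of "U * E" "U * F" Si])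
    show "U * E \<in> carrier_mat n r" "U * F \<in> carrier_mat n (n - r)"
      by (rule carrier_matI; simp)+
    show "?A (U * E) * (U * E) = 1\<^sub>m r" "?A (U * F) * (U * F) = 1\<^sub>m (n - r)"
      "?A (U * E) * (U * F) = 0\<^sub>m r (n - r)"
      using block(2-4) by (simp_all add: cancel)
    \<comment> \<open>\<open>S\<close> is moved into both summands of the adjoint to recreate the
      blocks \<open>S * Q\<close> and \<open>S * P\<close>.\<close>
    have "S * ?A (U * E * ?A Q + U * F * ?A P) = S * (Q * (?A E * ?A U) + P * (?A F * ?A U))"
      by (subst adj) (auto intro!: carrier_matI)
    also have "\<dots> = S * (Q * (?A E * ?A U)) + S * (P * (?A F * ?A U))"
      by (intro mult_add_distrib_mat[of _ r r _ n]) (rule carrier_matI; simp)+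
    also have "\<dots> = (S * Q * ?A E) * ?A U + (S * P * ?A F) * ?A U"
      by simp
    also have "\<dots> = (S * Q * ?A E + S * P * ?A F) * ?A U"
      by (intro add_mult_distrib_mat[of _ r n _ _ n, symmetric]) (rule carrier_matI; simp)+
    finally have "U * E * (S * ?A (U * E * ?A Q + U * F * ?A P)) =
        U * (E * (S * Q * ?A E + S * P * ?A F)) * ?A U"
      by simp
    then show "A = U * E * (S * ?A (U * E * ?A Q + U * F * ?A P))"
      unfolding A block(1) by (rule sym)
  qed (fact S' Si SSi SiS)+
qed

section \<open>Consequences of the EP property and the theorem\<close>

text \<open>\<open>D * P\<close> and its adjoint \<open>mat_adjoint P * D\<close> vanish, so
  multiplying \<open>QP\<close> by \<open>D\<close> on either side shows that
  \<open>Q * mat_adjoint Q\<close> fixes \<open>D\<close> from both sides.\<close>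

lemma commutators_of_annihilated_hermitian:
  fixes Q P D B :: "complex mat"
  assumes Q: "Q \<in> carrier_mat r r" and P: "P \<in> carrier_mat r m" and D: "D \<in> carrier_mat r r"
    and QP: "Q * mat_adjoint Q + P * mat_adjoint P = 1\<^sub>m r"
    and herm: "mat_adjoint D = D" and DP: "D * P = 0\<^sub>m r m"
  shows "mat_commutator (P * mat_adjoint P) D = 0\<^sub>m r r"
    and "mat_commutator (Q * mat_adjoint Q) D = 0\<^sub>m r r"
    and "D = Q * (mat_adjoint Q * D * Q) * mat_adjoint Q"
proof -
  let ?A = mat_adjoint
  have [simp]: "dim_row Q = r" "dim_col Q = r" "dim_row P = r" "dim_col P = m"
    "dim_row D = r" "dim_col D = r"
    using Q P D by auto
  note [simp] = mult_assoc_dim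
  have PD: "?A P * D = 0\<^sub>m m r"
    using arg_cong[OF DP, of ?A] by (simp add: mat_adjoint_mult herm)
  have PPD: "P * ?A P * D = 0\<^sub>m r r"
    using PD by simp
  have "D * (P * ?A P) = D * P * ?A P"
    by simp
  then have DPP: "D * (P * ?A P) = 0\<^sub>m r r"
    unfolding DP by simp
  have zero: "X + 0\<^sub>m r r = X" if "dim_row X = r" "dim_col X = r" for X :: "complex mat"
    using that by (intro right_add_zero_mat) (auto intro: carrier_matI)
  have "1\<^sub>m r * D = Q * ?A Q * D + P * ?A P * D"
    unfolding QP[symmetric] by (intro add_mult_distrib_mat[of _ r r _ _ r]) (rule carrier_matI; simp)+
  then have QQD: "Q * ?A Q * D = D"
    unfolding PPD using D by (simp add: zero)
  have "D * 1\<^sub>m r = D * (Q * ?A Q) + D * (P * ?A P)"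
    unfolding QP[symmetric] by (intro mult_add_distrib_mat[of _ r r _ r]) (rule carrier_matI; simp)+
  then have DQQ: "D * (Q * ?A Q) = D"
    unfolding DPP using D by (simp add: zero)
  show "mat_commutator (P * ?A P) D = 0\<^sub>m r r"
    unfolding mat_commutator_def PPD DPP by (intro eq_matI) auto
  show "mat_commutator (Q * ?A Q) D = 0\<^sub>m r r"
    unfolding mat_commutator_def QQD DQQ by (intro eq_matI) auto
  have "Q * (?A Q * D * Q) * ?A Q = Q * ?A Q * D * (Q * ?A Q)"
    by simp
  then show "D = Q * (?A Q * D * Q) * ?A Q"
    unfolding QQD DQQ by (rule sym)
qed

theorem corollary8:
  fixes n r :: nat and A U S Q P Qt \<Delta> :: "complex mat"
  assumes "A \<in> carrier_mat n n"
    and "mat_rank A = r" and "0 < r"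
    and "hartwig_spindelboeck n r A U S Q P"
    and "Qt = Q * core_EP_inverse (S * Q)"
    and "\<Delta> = Qt * mp_inverse Qt"
  shows "(EP_mat (CCE_inverse A) \<longleftrightarrow>
            mat_adjoint Q * \<Delta> * Q = mp_inverse Qt * Qt \<and>
            \<Delta> * P = 0\<^sub>m r (n - r))
       \<and> (EP_mat (CCE_inverse A) \<longrightarrow>
            mat_commutator (P * mat_adjoint P) \<Delta> = 0\<^sub>m r r \<and>
            mat_commutator (Q * mat_adjoint Q) \<Delta> = 0\<^sub>m r r \<and>
            \<Delta> = Q * mp_inverse Qt * Qt * mat_adjoint Q)"
proof -
  have "r \<le> n"
    using vec_space.rank_le_nc[of A n n] assms(1,2) by auto
  from assms(4) this obtain L K Si where iso: "L \<in> carrier_mat n r" "K \<in> carrier_mat n (n - r)"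
    "S \<in> carrier_mat r r" "Si \<in> carrier_mat r r" "S * Si = 1\<^sub>m r" "Si * S = 1\<^sub>m r"
    "mat_adjoint L * L = 1\<^sub>m r" "mat_adjoint K * K = 1\<^sub>m (n - r)" "mat_adjoint L * K = 0\<^sub>m r (n - r)"
    "A = L * (S * mat_adjoint (L * mat_adjoint Q + K * mat_adjoint P))"
    by (rule hartwig_spindelboeck_isometries)
  from assms(4) have Q: "Q \<in> carrier_mat r r" and P: "P \<in> carrier_mat r (n - r)"
    and QP: "Q * mat_adjoint Q + P * mat_adjoint P = 1\<^sub>m r"
    by (auto simp: hartwig_spindelboeck_def)
  have iff: "EP_mat (CCE_inverse A) \<longleftrightarrow>
      mat_adjoint Q * \<Delta> * Q = mp_inverse Qt * Qt \<and> \<Delta> * P = 0\<^sub>m r (n - r)"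
    by (rule EP_CCE_inverse_isometry[OF iso(1-4) Q P iso(7-9,5,6) QP refl iso(10) assms(5,6)])
  have "is_core_EP_inverse (S * Q) (core_EP_inverse (S * Q))"
    using iso(3) Q by (intro is_core_EP_inverse_core_EP_inverse[of _ r]) auto
  then have Qt: "Qt \<in> carrier_mat r r"
    using iso(3) Q by (auto simp: assms(5) is_core_EP_inverse_def)
  have mp: "is_mp_inverse Qt (mp_inverse Qt)"
    by (rule is_mp_inverse_mp_inverse)
  then have Y: "mp_inverse Qt \<in> carrier_mat r r"
    using Qt by (simp add: is_mp_inverse_def)
  have D: "\<Delta> \<in> carrier_mat r r" and herm: "mat_adjoint \<Delta> = \<Delta>"
    using mp Qt Y by (auto simp: assms(6) is_mp_inverse_def)
  \<comment> \<open>Rebracketing exposes \<open>mp_inverse Qt * Qt\<close>, which by (i) is the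
    middle factor in the formula for \<open>\<Delta>\<close>; this gives (3).\<close>
  have assoc: "Q * mp_inverse Qt * Qt * mat_adjoint Q = Q * (mp_inverse Qt * Qt) * mat_adjoint Q"
    using Q Qt Y by (simp add: mult_assoc_dim)
  show ?thesis
    using iff commutators_of_annihilated_hermitian[OF Q P D QP herm] assoc by metis
qed

end
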